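(* Let $G=(V,E)$ be a finite connected graph with edge set $E=\{e_1,\dots,e_m\}$, and let $\mathbf{w}_0=(w_{0,e})_{e\in E}$ be an initial weight vector with $w_{0,e}>0$ for all $e\in E$. Consider the discrete Ricci curvature flow with step size $s>0$, $$w_e^{(j+1)}=w_e^{(j)}-s\,\kappa_e^{(j)}\rho_e^{(j)},\qquad w_e^{(j)}>0,\qquad w_e^{(0)}=w_{0,e},\qquad j\in\mathbb{N},\ e\in E. \quad ( * )$$ (i) If $\kappa$ is Ollivier's Ricci curvature, then for any $0<s<1$ the flow $( * )$ has a unique global solution $(w_e^{(j)})_{j\in\mathbb{N}}$, $e\in E$; moreover, $$(1-s)^j w_{0,e}\le w_e^{(j)}\le (1+ms)^j\sum_{\tau\in E}w_{0,\tau},\qquad \forall j\in\mathbb{N},\ \forall e\in E.$$ (ii) If $\kappa$ is Lin-Lu-Yau's Ricci curvature, then for any $0<s<1/2$ the flow $( * )$ has a unique global solution $(w_e^{(j)})_{j\in\mathbb{N}}$, $e\in E$; moreover, $$(1-2s)^j w_{0,e}\le w_e^{(j)}\le (1+2ms)^j\sum_{\tau\in E}w_{0,\tau},\qquad \forall j\in\mathbb{N},\ \forall e\in E.$$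
   Context: Graphs are finite, undirected, simple and connected, with at least one edge; $\mathbb{N}$ includes $0$; $m=|E|$. For positive edge weights $\mathbf{w}=(w_e)_{e\in E}$ (write $w_{xy}=w_e$ for $e=xy$), the distance is $d(x,y)=\inf_\gamma\sum_{e\in\gamma}w_e$ over all paths $\gamma$ connecting $x$ and $y$. For an edge $e=xy$, $\rho_e=d(x,y)$ (so $\rho_e\le w_e$). For $\alpha\in[0,1]$ and $x\in V$, the $\alpha$-lazy one-step random walk is the probability measure with $\mu_x^\alpha(x)=\alpha$, $\mu_x^\alpha(z)=(1-\alpha)\,w_{xz}/\sum_{u\sim x}w_{xu}$ if $z\sim x$, and $\mu_x^\alpha(z)=0$ otherwise. For probability measures $\mu_1,\mu_2$ on $V$, the Wasserstein distance is $W(\mu_1,\mu_2)=\inf_A\sum_{u,v\in V}A(u,v)d(u,v)$ over all couplings $A:V\times V\to[0,1]$, i.e. $\sum_{x\in V}A(u,x)=\mu_1(u)$ and $\sum_{y\in V}A(y,v)=\mu_2(v)$ for all $u,v\in V$. Ollivier's Ricci curvature (for a fixed $\alpha$) on an edge $e=xy$ is $\kappa_e^\alpha=1-W(\mu_x^\alpha,\mu_y^\alpha)/\rho_e$; in statements about Ollivier's curvature, $\kappa_e=\kappa_e^\alpha$ for this fixed $\alpha$. Lin-Lu-Yau's Ricci curvature is $\kappa_e=\lim_{\alpha\to1^-}\kappa_e^\alpha/(1-\alpha)$. $\kappa_e^{(j)}$ and $\rho_e^{(j)}$ denote the curvature and the distance between the endpoints of $e$ computed from the weights $\mathbf{w}^{(j)}$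 (both the random walks and the distance use $\mathbf{w}^{(j)}$). A global solution is a sequence of vectors $\mathbf{w}^{(j)}$, $j\in\mathbb{N}$, with all entries positive, satisfying the recursion and the initial condition. *)

theory Defs
  imports Complex_Main "HOL-Library.FuncSet"
begin

definition simple_graph :: "'a set \<Rightarrow> 'a set set \<Rightarrow> bool" where
  "simple_graph V E \<longleftrightarrow> finite V \<and> E \<subseteq> {{x, y} |x y. x \<in> V \<and> y \<in> V \<and> x \<noteq> y}"

text \<open>A path is given by its list of vertices; the one-element list \<open>[x]\<close> is the
  trivial path from \<open>x\<close> to \<open>x\<close>.\<close>

definition paths :: "'a set set \<Rightarrow> 'a \<Rightarrow> 'a \<Rightarrow> 'a list set" where
  "paths E x y = {p. p \<noteq> [] \<and> hd p = x \<and> last p = y \<and> distinct p \<and>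
                     successively (\<lambda>u v. {u, v} \<in> E) p}"

definition connected_graph :: "'a set \<Rightarrow> 'a set set \<Rightarrow> bool" where
  "connected_graph V E \<longleftrightarrow> simple_graph V E \<and> (\<forall>x\<in>V. \<forall>y\<in>V. paths E x y \<noteq> {})"

definition path_length :: "('a set \<Rightarrow> real) \<Rightarrow> 'a list \<Rightarrow> real" where
  "path_length w p = sum_list (map (\<lambda>(u, v). w {u, v}) (zip p (tl p)))"

definition graph_dist :: "'a set set \<Rightarrow> ('a set \<Rightarrow> real) \<Rightarrow> 'a \<Rightarrow> 'a \<Rightarrow> real" where
  "graph_dist E w x y = (INF p\<in>paths E x y. path_length w p)"

definition lazy_walk :: "'a set set \<Rightarrow> ('a set \<Rightarrow> real) \<Rightarrow> real \<Rightarrow> 'a \<Rightarrow> 'a \<Rightarrow> real" where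
  "lazy_walk E w \<alpha> x z =
     (if z = x then \<alpha>
      else if {x, z} \<in> E then (1 - \<alpha>) * w {x, z} / (\<Sum>u | {x, u} \<in> E. w {x, u})
      else 0)"

definition couplings :: "'a set \<Rightarrow> ('a \<Rightarrow> real) \<Rightarrow> ('a \<Rightarrow> real) \<Rightarrow> ('a \<Rightarrow> 'a \<Rightarrow> real) set" where
  "couplings V \<mu>1 \<mu>2 =
     {A. (\<forall>u\<in>V. \<forall>v\<in>V. 0 \<le> A u v \<and> A u v \<le> 1) \<and>
         (\<forall>u\<in>V. (\<Sum>x\<in>V. A u x) = \<mu>1 u) \<and>
         (\<forall>v\<in>V. (\<Sum>y\<in>V. A y v) = \<mu>2 v)}"

definition wasserstein ::
  "'a set \<Rightarrow> ('a \<Rightarrow> 'a \<Rightarrow> real) \<Rightarrow> ('a \<Rightarrow> real) \<Rightarrow> ('a \<Rightarrow> real) \<Rightarrow> real" where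
  "wasserstein V d \<mu>1 \<mu>2 =
     (INF A\<in>couplings V \<mu>1 \<mu>2. \<Sum>u\<in>V. \<Sum>v\<in>V. A u v * d u v)"

text \<open>Both curvatures are written in terms of the two endpoints of an edge; they are symmetric
  in the endpoints.\<close>

definition ollivier_curvature ::
  "'a set \<Rightarrow> 'a set set \<Rightarrow> real \<Rightarrow> ('a set \<Rightarrow> real) \<Rightarrow> 'a \<Rightarrow> 'a \<Rightarrow> real" where
  "ollivier_curvature V E \<alpha> w x y =
     1 - wasserstein V (graph_dist E w) (lazy_walk E w \<alpha> x) (lazy_walk E w \<alpha> y)
         / graph_dist E w x y"

definition lin_lu_yau_curvature ::
  "'a set \<Rightarrow> 'a set set \<Rightarrow> ('a set \<Rightarrow> real) \<Rightarrow> 'a \<Rightarrow> 'a \<Rightarrow> real" where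
  "lin_lu_yau_curvature V E w x y =
     Lim (at_left 1) (\<lambda>\<alpha>. ollivier_curvature V E \<alpha> w x y / (1 - \<alpha>))"

text \<open>Weight vectors are functions on \<open>E\<close> in the extensional sense (equal to \<open>undefined\<close>
  off \<open>E\<close>), so that equality of solutions means equality on \<open>E\<close>.\<close>

definition global_solution ::
  "'a set set \<Rightarrow> (('a set \<Rightarrow> real) \<Rightarrow> 'a \<Rightarrow> 'a \<Rightarrow> real) \<Rightarrow> real \<Rightarrow> ('a set \<Rightarrow> real) \<Rightarrow>
   (nat \<Rightarrow> 'a set \<Rightarrow> real) \<Rightarrow> bool" where
  "global_solution E \<kappa> s w0 w \<longleftrightarrow>
     (\<forall>j. w j \<in> E \<rightarrow>\<^sub>E {0<..}) \<and>
     (\<forall>e\<in>E. w 0 e = w0 e) \<and>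
     (\<forall>j x y. {x, y} \<in> E \<longrightarrow>
        w (Suc j) {x, y} = w j {x, y} - s * \<kappa> (w j) x y * graph_dist E (w j) x y)"

end

theory Submission imports Defs begin

text \<open>Multiplied by the distance \<open>\<rho>\<close> between the endpoints, Ollivier's curvature is \<open>\<rho> - W\<close>
  with \<open>0 \<le> W \<le> S\<close>, where \<open>S\<close> is the total weight: a coupling has total mass one, and a path
  does not repeat an edge. The total weight thus grows by at most the factor \<open>1 + m s\<close> in one
  step, while no weight shrinks by more than the factor \<open>1 - s\<close>.

  For Lin-Lu-Yau's curvature, mixing a coupling at laziness \<open>\<beta>\<close> with the point coupling at
  laziness \<open>1\<close> shows that \<open>\<kappa>\<^sup>\<alpha> / (1 - \<alpha>)\<close> increases with \<open>\<alpha>\<close>. It is bounded above by \<open>2\<close>, since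
  any coupling puts mass at least \<open>2 \<alpha> - 1\<close> on the pair of endpoints. So the limit
  exists and lies between \<open>\<kappa>\<^sup>0\<close> and \<open>2\<close>.\<close>

section \<open>Path lengths, and symmetry of distance and curvature in the endpoints\<close>

lemma path_length_simps [simp]:
  "path_length w [] = 0"
  "path_length w [x] = 0"
  "path_length w (x # y # p) = w {x, y} + path_length w (y # p)"
  by (auto simp: path_length_def)

lemma path_length_snoc:
  "path_length w (p @ [x, y]) = path_length w (p @ [x]) + w {x, y}"
proof (induction p)
  case (Cons a p)
  then show ?case by (cases p) auto
qed simp

lemma path_length_rev [simp]: "path_length w (rev p) = path_length w p"
  by (induction p rule: induct_list012) (auto simp: path_length_snoc insert_commute)

lemma rev_in_paths: "p \<in> paths E x y \<Longrightarrow> rev p \<in> paths E y x"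
  by (auto simp: paths_def hd_rev last_rev insert_commute)

lemma paths_commute: "paths E y x = rev ` paths E x y"
proof
  show "paths E y x \<subseteq> rev ` paths E x y"
  proof
    fix p assume "p \<in> paths E y x"
    then show "p \<in> rev ` paths E x y"
      by (intro image_eqI[of _ _ "rev p"]) (simp_all add: rev_in_paths)
  qed
qed (auto intro: rev_in_paths)

lemma graph_dist_commute: "graph_dist E w x y = graph_dist E w y x"
  unfolding graph_dist_def paths_commute[of E y x] by (simp add: image_image)

lemma couplings_transpose: "A \<in> couplings V \<mu> \<nu> \<Longrightarrow> (\<lambda>u v. A v u) \<in> couplings V \<nu> \<mu>"
  by (auto simp: couplings_def)

text \<open>Transposition carries the couplings of one ordered pair of measures to those of the
  reversed pair and keeps the cost, so both infima range over the same set of reals.\<close>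

lemma wasserstein_commute:
  assumes "\<And>u v. d u v = d v u"
  shows "wasserstein V d \<mu> \<nu> = wasserstein V d \<nu> \<mu>"
proof -
  let ?c = "\<lambda>A. \<Sum>u\<in>V. \<Sum>v\<in>V. A u v * d u v"
  have "?c ` couplings V a b \<subseteq> ?c ` couplings V b a" for a b
  proof
    fix r assume "r \<in> ?c ` couplings V a b"
    then obtain A where A: "A \<in> couplings V a b" "r = ?c A" by auto
    show "r \<in> ?c ` couplings V b a"
    proof (rule image_eqI)
      show "r = ?c (\<lambda>u v. A v u)"
        unfolding A(2) by (subst sum.swap) (simp add: assms)
    qed (rule couplings_transpose[OF A(1)])
  qed
  then have "?c ` couplings V \<mu> \<nu> = ?c ` couplings V \<nu> \<mu>" by blast
  then show ?thesis unfolding wasserstein_def by simp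
qed

lemma ollivier_curvature_commute:
  "ollivier_curvature V E \<alpha> w x y = ollivier_curvature V E \<alpha> w y x"
  unfolding ollivier_curvature_def
  using wasserstein_commute[of "graph_dist E w" V "lazy_walk E w \<alpha> x" "lazy_walk E w \<alpha> y",
      OF graph_dist_commute] graph_dist_commute[of E w x y]
  by simp

lemma lin_lu_yau_curvature_commute:
  "lin_lu_yau_curvature V E w x y = lin_lu_yau_curvature V E w y x"
  unfolding lin_lu_yau_curvature_def by (simp add: ollivier_curvature_commute[of V E _ w x y])

section \<open>Couplings of arbitrary measures\<close>

lemma product_coupling:
  assumes "finite V" "\<And>v. v \<in> V \<Longrightarrow> 0 \<le> \<mu> v" "\<And>v. v \<in> V \<Longrightarrow> 0 \<le> \<nu> v"
    and "sum \<mu> V = 1" "sum \<nu> V = 1"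
  shows "(\<lambda>u v. \<mu> u * \<nu> v) \<in> couplings V \<mu> \<nu>"
proof -
  have le1: "\<mu> v \<le> 1" "\<nu> v \<le> 1" if "v \<in> V" for v
    using member_le_sum[of v V \<mu>] member_le_sum[of v V \<nu>] that assms by auto
  then show ?thesis
    using assms unfolding couplings_def
    by (auto simp: mult_le_one sum_distrib_left[symmetric] sum_distrib_right[symmetric])
qed

text \<open>The marginal conditions are linear in the coupling, and the bounds \<open>0\<close> and
  \<open>1\<close> survive convex combinations.\<close>

lemma couplings_mix:
  assumes "A \<in> couplings V \<mu> \<nu>" "B \<in> couplings V \<mu>' \<nu>'" "0 \<le> t" "t \<le> 1"
  shows "(\<lambda>u v. t * A u v + (1 - t) * B u v)
    \<in> couplings V (\<lambda>u. t * \<mu> u + (1 - t) * \<mu>' u) (\<lambda>v. t * \<nu> v + (1 - t) * \<nu>' v)"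
  using assms unfolding couplings_def
  by (auto simp: sum.distrib sum_distrib_left[symmetric] intro!: convex_bound_le)

lemma coupling_total_mass:
  assumes "A \<in> couplings V \<mu> \<nu>" "sum \<mu> V = 1"
  shows "(\<Sum>u\<in>V. \<Sum>v\<in>V. A u v) = 1"
  using assms by (simp add: couplings_def)

text \<open>Row \<open>x\<close> carries mass \<open>\<mu> x\<close>. Outside column
  \<open>y\<close> it can place at most what the other columns receive altogether, which is
  \<open>1 - \<nu> y\<close>; the rest must sit at \<open>(x, y)\<close>.\<close>

lemma coupling_mass_ge:
  assumes "A \<in> couplings V \<mu> \<nu>" "finite V" "sum \<nu> V = 1" "x \<in> V" "y \<in> V"
  shows "A x y \<ge> \<mu> x + \<nu> y - 1"
proof -
  have "\<mu> x = A x y + (\<Sum>v\<in>V - {y}. A x v)"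
    using assms by (auto simp: couplings_def sum.remove[symmetric])
  also have "(\<Sum>v\<in>V - {y}. A x v) \<le> (\<Sum>v\<in>V - {y}. \<nu> v)"
  proof (rule sum_mono)
    fix v assume "v \<in> V - {y}"
    then show "A x v \<le> \<nu> v"
      using assms member_le_sum[of x V "\<lambda>u. A u v"] by (auto simp: couplings_def)
  qed
  also have "\<dots> = 1 - \<nu> y"
    using assms by (simp add: sum_diff1)
  finally show ?thesis by linarith
qed

section \<open>Distances in a graph with positive edge weights\<close>

locale weighted_graph =
  fixes V :: "'a set" and E :: "'a set set" and w :: "'a set \<Rightarrow> real"
  assumes connected: "connected_graph V E"
    and weight_pos: "e \<in> E \<Longrightarrow> 0 < w e"
begin

abbreviation "d \<equiv> graph_dist E w"

abbreviation "total_weight \<equiv> sum w E"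

abbreviation "W \<alpha> x y \<equiv> wasserstein V d (lazy_walk E w \<alpha> x) (lazy_walk E w \<alpha> y)"

lemma finite_vertices: "finite V"
  using connected by (auto simp: connected_graph_def simple_graph_def)

lemma edgeD:
  assumes "{x, y} \<in> E"
  shows "x \<in> V" "y \<in> V" "x \<noteq> y"
  using connected assms
  by (auto simp: connected_graph_def simple_graph_def doubleton_eq_iff dest!: subsetD)

lemma finite_edges: "finite E"
proof (rule finite_subset)
  show "E \<subseteq> Pow V"
    using connected by (auto simp: connected_graph_def simple_graph_def)
qed (simp add: finite_vertices)

lemma paths_nonempty: "x \<in> V \<Longrightarrow> y \<in> V \<Longrightarrow> paths E x y \<noteq> {}"
  using connected by (auto simp: connected_graph_def)

lemma weight_nonneg: "e \<in> E \<Longrightarrow> 0 \<le> w e"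
  using weight_pos[of e] by simp

lemma path_length_nonneg:
  "successively (\<lambda>u v. {u, v} \<in> E) p \<Longrightarrow> 0 \<le> path_length w p"
  by (induction p rule: induct_list012) (auto intro!: add_nonneg_nonneg weight_nonneg)

text \<open>The sum over the edges inside \<open>set p\<close> makes the induction work: the first edge of
  a simple path is not inside the remaining vertex set.\<close>

lemma path_length_le_aux:
  assumes "successively (\<lambda>u v. {u, v} \<in> E) p" "distinct p"
  shows "path_length w p \<le> sum w {e \<in> E. e \<subseteq> set p}"
  using assms
proof (induction p rule: induct_list012)
  case (3 x y p)
  let ?F = "{e \<in> E. e \<subseteq> set (y # p)}"
  have "w {x, y} + path_length w (y # p) \<le> w {x, y} + sum w ?F"
    using 3 by simp
  also have "\<dots> = sum w (insert {x, y} ?F)"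
    using 3(4) finite_edges by (subst sum.insert) auto
  also have "\<dots> \<le> sum w {e \<in> E. e \<subseteq> set (x # y # p)}"
    using 3(3) finite_edges by (intro sum_mono2) (auto intro: weight_nonneg)
  finally show ?case by simp
qed (auto intro!: sum_nonneg weight_nonneg)

lemma path_length_le:
  assumes "p \<in> paths E x y"
  shows "path_length w p \<le> total_weight"
proof -
  have "path_length w p \<le> sum w {e \<in> E. e \<subseteq> set p}"
    using assms by (intro path_length_le_aux) (auto simp: paths_def)
  also have "\<dots> \<le> total_weight"
    using finite_edges by (intro sum_mono2) (auto intro: weight_nonneg)
  finally show ?thesis .
qed

lemma graph_dist_le_path:
  assumes "p \<in> paths E x y"
  shows "d x y \<le> path_length w p"
  unfolding graph_dist_def
proof (rule cINF_lower)
  show "bdd_below (path_length w ` paths E x y)"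
    by (rule bdd_belowI[of _ 0]) (auto simp: paths_def intro: path_length_nonneg)
qed (rule assms)

lemma graph_dist_le_total:
  assumes "x \<in> V" "y \<in> V"
  shows "d x y \<le> total_weight"
proof -
  obtain p where "p \<in> paths E x y" using paths_nonempty assms by blast
  then show ?thesis using graph_dist_le_path path_length_le order_trans by blast
qed

lemma graph_dist_nonneg:
  assumes "x \<in> V" "y \<in> V"
  shows "0 \<le> d x y"
  unfolding graph_dist_def using paths_nonempty[OF assms]
  by (rule cINF_greatest) (simp add: paths_def path_length_nonneg)

lemma graph_dist_le_weight:
  assumes "{x, y} \<in> E"
  shows "d x y \<le> w {x, y}"
  using graph_dist_le_path[of "[x, y]" x y] assms edgeD[OF assms] by (auto simp: paths_def)

text \<open>Every path between distinct vertices contains an edge, so the least edge weight is a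
  positive lower bound for all path lengths at once and passes to the infimum. Positivity allows the
  division by the distance in the curvature to be cancelled.\<close>

lemma graph_dist_pos:
  assumes "x \<in> V" "y \<in> V" "x \<noteq> y"
  shows "0 < d x y"
proof -
  have first_edge: "\<exists>e\<in>E. w e \<le> path_length w p" if path: "p \<in> paths E x y" for p
  proof -
    obtain u v q where p: "p = u # v # q"
      using path assms(3) by (cases p rule: remdups_adj.cases) (auto simp: paths_def)
    then have "{u, v} \<in> E" "0 \<le> path_length w (v # q)"
      using path by (auto simp: paths_def intro: path_length_nonneg)
    then show ?thesis using p by (intro bexI[of _ "{u, v}"]) simp_all
  qed
  then have "E \<noteq> {}" using paths_nonempty assms by blast
  have "Min (w ` E) \<le> d x y"
    unfolding graph_dist_def
  proof (rule cINF_greatest)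
    fix p assume "p \<in> paths E x y"
    then obtain e where "e \<in> E" "w e \<le> path_length w p" using first_edge by blast
    then show "Min (w ` E) \<le> path_length w p"
      using finite_edges by (meson Min_le finite_imageI imageI order_trans)
  qed (use paths_nonempty assms in auto)
  moreover have "0 < Min (w ` E)"
    using finite_edges \<open>E \<noteq> {}\<close> weight_pos by (simp add: Min_gr_iff)
  ultimately show ?thesis by linarith
qed

section \<open>Lazy random walks and the Wasserstein distance between them\<close>

lemma finite_neighbours: "finite {u. {x, u} \<in> E}"
  by (rule finite_subset[OF _ finite_vertices]) (auto dest: edgeD)

lemma lazy_walk_nonneg:
  assumes "0 \<le> \<alpha>" "\<alpha> \<le> 1"
  shows "0 \<le> lazy_walk E w \<alpha> x z"
  using assms unfolding lazy_walk_def
  by (auto intro!: divide_nonneg_nonneg mult_nonneg_nonneg sum_nonneg weight_nonneg)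

lemma sum_lazy_walk:
  assumes "{x, y} \<in> E"
  shows "sum (lazy_walk E w \<alpha> x) V = 1"
proof -
  let ?N = "{u. {x, u} \<in> E}" and ?D = "\<Sum>u | {x, u} \<in> E. w {x, u}"
  have "0 < ?D"
    using assms finite_neighbours by (intro sum_pos) (auto intro: weight_pos)
  have "sum (lazy_walk E w \<alpha> x) V = \<alpha> + sum (lazy_walk E w \<alpha> x) (V - {x})"
    using edgeD(1)[OF assms] finite_vertices by (simp add: sum.remove lazy_walk_def)
  also have "sum (lazy_walk E w \<alpha> x) (V - {x}) = sum (lazy_walk E w \<alpha> x) ?N"
    using finite_vertices by (intro sum.mono_neutral_right) (auto simp: lazy_walk_def dest: edgeD)
  \<comment> \<open>There is no loop at \<open>x\<close>, so the first case of
    \<open>lazy_walk\<close> never applies on \<open>?N\<close>.\<close>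
  also have "\<dots> = (\<Sum>u\<in>?N. (1 - \<alpha>) * w {x, u} / ?D)"
    using edgeD(3)[of x x] by (intro sum.cong) (auto simp: lazy_walk_def)
  also have "\<dots> = 1 - \<alpha>"
    using \<open>0 < ?D\<close> by (simp add: sum_divide_distrib[symmetric] sum_distrib_left[symmetric])
  finally show ?thesis by simp
qed

abbreviation "cost A \<equiv> \<Sum>u\<in>V. \<Sum>v\<in>V. A u v * d u v"

text \<open>The lower bounds on the Wasserstein distance below come from
  \<open>cINF_greatest\<close>, which asks for a nonempty index set; the product coupling is a
  witness. The edge gives both endpoints a neighbour, so both walks have total mass one.\<close>

lemma couplings_lazy_walk_nonempty:
  assumes "{x, y} \<in> E" "0 \<le> \<alpha>" "\<alpha> \<le> 1"
  shows "couplings V (lazy_walk E w \<alpha> x) (lazy_walk E w \<alpha> y) \<noteq> {}"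
proof -
  have "{y, x} \<in> E" using assms(1) by (simp add: insert_commute)
  then show ?thesis
    using product_coupling[OF finite_vertices lazy_walk_nonneg[OF assms(2,3)]
        lazy_walk_nonneg[OF assms(2,3)] sum_lazy_walk[OF assms(1)] sum_lazy_walk]
    by auto
qed

lemma cost_nonneg:
  assumes "A \<in> couplings V \<mu> \<nu>"
  shows "0 \<le> cost A"
  using assms
  by (auto simp: couplings_def intro!: sum_nonneg mult_nonneg_nonneg graph_dist_nonneg)

lemma wasserstein_le_cost:
  assumes "A \<in> couplings V \<mu> \<nu>"
  shows "wasserstein V d \<mu> \<nu> \<le> cost A"
  unfolding wasserstein_def
proof (rule cINF_lower)
  show "bdd_below (cost ` couplings V \<mu> \<nu>)"
    by (rule bdd_belowI[of _ 0]) (auto intro: cost_nonneg)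
qed (rule assms)

lemma wasserstein_nonneg:
  assumes "{x, y} \<in> E" "0 \<le> \<alpha>" "\<alpha> \<le> 1"
  shows "0 \<le> W \<alpha> x y"
  unfolding wasserstein_def
  using couplings_lazy_walk_nonempty[OF assms] by (rule cINF_greatest) (rule cost_nonneg)

lemma wasserstein_le_total:
  assumes "{x, y} \<in> E" "0 \<le> \<alpha>" "\<alpha> \<le> 1"
  shows "W \<alpha> x y \<le> total_weight"
proof -
  obtain A where A: "A \<in> couplings V (lazy_walk E w \<alpha> x) (lazy_walk E w \<alpha> y)"
    using couplings_lazy_walk_nonempty[OF assms] by blast
  have "W \<alpha> x y \<le> cost A" by (rule wasserstein_le_cost[OF A])
  also have "\<dots> \<le> (\<Sum>u\<in>V. \<Sum>v\<in>V. A u v * total_weight)"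
    using A by (intro sum_mono mult_left_mono graph_dist_le_total) (auto simp: couplings_def)
  also have "\<dots> = total_weight"
    using coupling_total_mass[OF A sum_lazy_walk[OF assms(1)]]
    by (simp add: sum_distrib_right[symmetric])
  finally show ?thesis .
qed

section \<open>Dependence of Ollivier's curvature on the laziness, and the limit at laziness
  one\<close>

lemma ollivier_curvature_times_dist:
  assumes "{x, y} \<in> E"
  shows "ollivier_curvature V E \<alpha> w x y * d x y = d x y - W \<alpha> x y"
  using graph_dist_pos[OF edgeD[OF assms]] by (simp add: ollivier_curvature_def field_simps)

text \<open>The walks keep mass \<open>\<alpha>\<close> at \<open>x\<close> and at \<open>y\<close>
  respectively, so by \<open>coupling_mass_ge\<close> every coupling moves at least
  \<open>2 * \<alpha> - 1\<close> from \<open>x\<close> to \<open>y\<close>, at cost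
  \<open>d x y\<close> per unit. All other terms of the cost are nonnegative.\<close>

lemma wasserstein_ge:
  assumes "{x, y} \<in> E" "0 \<le> \<alpha>" "\<alpha> \<le> 1"
  shows "(2 * \<alpha> - 1) * d x y \<le> W \<alpha> x y"
  unfolding wasserstein_def
  using couplings_lazy_walk_nonempty[OF assms]
proof (rule cINF_greatest)
  fix A assume A: "A \<in> couplings V (lazy_walk E w \<alpha> x) (lazy_walk E w \<alpha> y)"
  note V = edgeD[OF assms(1)]
  have "2 * \<alpha> - 1 \<le> A x y"
    using coupling_mass_ge[OF A finite_vertices sum_lazy_walk[of y x] V(1,2)] assms(1)
    by (simp add: lazy_walk_def insert_commute)
  then have "(2 * \<alpha> - 1) * d x y \<le> A x y * d x y"
    using V by (intro mult_right_mono graph_dist_nonneg)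
  also have "\<dots> \<le> (\<Sum>v\<in>V. A x v * d x v)"
    using A V finite_vertices
    by (intro member_le_sum[of y V "\<lambda>v. A x v * d x v"])
      (auto simp: couplings_def intro!: mult_nonneg_nonneg graph_dist_nonneg)
  also have "\<dots> \<le> cost A"
    using A V finite_vertices
    by (intro member_le_sum[of x V "\<lambda>u. \<Sum>v\<in>V. A u v * d u v"])
      (auto simp: couplings_def intro!: sum_nonneg mult_nonneg_nonneg graph_dist_nonneg)
  finally show "(2 * \<alpha> - 1) * d x y \<le> cost A" .
qed

text \<open>The walk is affine in its laziness, and \<open>1 - t * (1 - \<beta>)\<close> is the
  mixture of \<open>\<beta>\<close> and \<open>1\<close> with weights \<open>t\<close> and
  \<open>1 - t\<close>. Couplings mix in the same way, and the cost is linear.\<close>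

lemma wasserstein_mix:
  assumes "{x, y} \<in> E" "0 \<le> \<beta>" "\<beta> \<le> 1" "0 < t" "t \<le> 1"
  shows "W (1 - t * (1 - \<beta>)) x y \<le> t * W \<beta> x y + (1 - t) * d x y"
proof -
  \<comment> \<open>At laziness one the walks are the point masses at \<open>x\<close> and
    \<open>y\<close>, and \<open>B\<close> couples them by moving everything from \<open>x\<close>
    to \<open>y\<close>.\<close>
  define B where "B = (\<lambda>u v. if u = x \<and> v = y then 1 else 0 :: real)"
  note V = edgeD[OF assms(1)]
  have walk_mix: "lazy_walk E w (1 - t * (1 - \<beta>)) z =
      (\<lambda>u. t * lazy_walk E w \<beta> z u + (1 - t) * lazy_walk E w 1 z u)" for z
    by (rule ext) (auto simp: lazy_walk_def algebra_simps)
  have B: "B \<in> couplings V (lazy_walk E w 1 x) (lazy_walk E w 1 y)"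
    using V finite_vertices by (auto simp: couplings_def B_def lazy_walk_def)
  have "(\<Sum>v\<in>V. B u v * d u v) = (if u = x then d x y else 0)" for u
    using V finite_vertices by (simp add: B_def if_distrib[of "\<lambda>r. r * _"] cong: if_cong)
  then have cost_B: "cost B = d x y"
    using V finite_vertices by simp
  \<comment> \<open>The claim is solved for \<open>W \<beta> x y\<close>, so that it becomes a lower
    bound on an infimum and can be checked for each coupling \<open>A\<close> separately. Only this
    infimum is unfolded.\<close>
  have "(W (1 - t * (1 - \<beta>)) x y - (1 - t) * d x y) / t \<le> W \<beta> x y"
    unfolding wasserstein_def[of V d "lazy_walk E w \<beta> x"]
    using couplings_lazy_walk_nonempty[OF assms(1-3)]
  proof (rule cINF_greatest)
    fix A assume A: "A \<in> couplings V (lazy_walk E w \<beta> x) (lazy_walk E w \<beta> y)"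
    have "W (1 - t * (1 - \<beta>)) x y \<le> cost (\<lambda>u v. t * A u v + (1 - t) * B u v)"
      unfolding walk_mix using assms by (intro wasserstein_le_cost couplings_mix A B) auto
    also have "\<dots> = t * cost A + (1 - t) * cost B"
      by (simp add: sum.distrib sum_distrib_left algebra_simps sum_subtractf)
    finally show "(W (1 - t * (1 - \<beta>)) x y - (1 - t) * d x y) / t \<le> cost A"
      using assms cost_B by (simp add: field_simps)
  qed
  then show ?thesis using assms by (simp add: field_simps)
qed

lemma ollivier_curvature_ratio_mono:
  assumes "{x, y} \<in> E" "0 \<le> \<beta>" "\<beta> \<le> \<alpha>" "\<alpha> < 1"
  shows "ollivier_curvature V E \<beta> w x y / (1 - \<beta>) \<le> ollivier_curvature V E \<alpha> w x y / (1 - \<alpha>)"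
proof -
  \<comment> \<open>Chosen so that mixing laziness \<open>\<beta>\<close> with laziness one gives
    exactly laziness \<open>\<alpha>\<close>.\<close>
  define t where "t = (1 - \<alpha>) / (1 - \<beta>)"
  have t: "0 < t" "t \<le> 1" "t * (1 - \<beta>) = 1 - \<alpha>"
    using assms by (auto simp: t_def)
  let ?K = "\<lambda>\<alpha>. ollivier_curvature V E \<alpha> w x y"
  have d: "0 < d x y" by (rule graph_dist_pos[OF edgeD[OF assms(1)]])
  have "W \<alpha> x y \<le> t * W \<beta> x y + (1 - t) * d x y"
    using wasserstein_mix[of x y \<beta> t] assms t by simp
  then have "t * (?K \<beta> * d x y) \<le> ?K \<alpha> * d x y"
    unfolding ollivier_curvature_times_dist[OF assms(1)] by (simp add: algebra_simps)
  then have "t * ?K \<beta> \<le> ?K \<alpha>"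
    using d by (simp add: mult.assoc[symmetric])
  then show ?thesis
    using assms by (simp add: t_def field_simps)
qed

lemma ollivier_curvature_ratio_le:
  assumes "{x, y} \<in> E" "0 \<le> \<alpha>" "\<alpha> < 1"
  shows "ollivier_curvature V E \<alpha> w x y / (1 - \<alpha>) \<le> 2"
proof -
  have "ollivier_curvature V E \<alpha> w x y * d x y \<le> (2 * (1 - \<alpha>)) * d x y"
    unfolding ollivier_curvature_times_dist[OF assms(1)]
    using wasserstein_ge[OF assms(1)] assms by (simp add: algebra_simps)
  then have "ollivier_curvature V E \<alpha> w x y \<le> 2 * (1 - \<alpha>)"
    using graph_dist_pos[OF edgeD[OF assms(1)]] by (rule mult_right_le_imp_le)
  then show ?thesis using assms by (simp add: field_simps)
qed

text \<open>The ratio \<open>?h\<close> is increasing and bounded on \<open>{0..<1}\<close>, so its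
  left limit at one is its supremum \<open>L\<close>. The lower bound is the value at
  \<open>0\<close>, where the denominator is \<open>1\<close>.\<close>

lemma lin_lu_yau_curvature_bounds:
  assumes "{x, y} \<in> E"
  shows "ollivier_curvature V E 0 w x y \<le> lin_lu_yau_curvature V E w x y"
    and "lin_lu_yau_curvature V E w x y \<le> 2"
proof -
  let ?h = "\<lambda>\<alpha>. ollivier_curvature V E \<alpha> w x y / (1 - \<alpha>)"
  define L where "L = Sup (?h ` {0..<1})"
  have bdd: "bdd_above (?h ` {0..<1})"
    using ollivier_curvature_ratio_le[OF assms] by (intro bdd_aboveI[of _ 2]) auto
  have upper: "?h \<alpha> \<le> L" if "\<alpha> \<in> {0..<1}" for \<alpha>
    unfolding L_def by (rule cSUP_upper[OF that bdd])
  have eventually_ge: "\<forall>\<^sub>F \<alpha> in at_left 1. \<alpha> \<in> {\<beta>..<1}" if "\<beta> < 1" for \<beta> :: real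
    using eventually_at_left_real[OF that] by eventually_elim auto
  have "(?h \<longlongrightarrow> L) (at_left 1)"
  proof (rule increasing_tendsto)
    show "\<forall>\<^sub>F \<alpha> in at_left 1. ?h \<alpha> \<le> L"
      using eventually_ge[of 0] upper by (auto elim: eventually_mono)
    fix r assume "r < L"
    then obtain \<beta> where \<beta>: "\<beta> \<in> {0..<1}" "r < ?h \<beta>"
      unfolding L_def using less_cSUP_iff[OF _ bdd, of r] by auto
    have "\<forall>\<^sub>F \<alpha> in at_left 1. \<alpha> \<in> {\<beta>..<1}" using \<beta> by (intro eventually_ge) auto
    then show "\<forall>\<^sub>F \<alpha> in at_left 1. r < ?h \<alpha>"
    proof eventually_elim
      case (elim \<alpha>)
      have "?h \<beta> \<le> ?h \<alpha>"
        using elim \<beta> by (intro ollivier_curvature_ratio_mono assms) auto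
      then show ?case using \<beta>(2) by linarith
    qed
  qed
  \<comment> \<open>\<open>Lim\<close> is a definite description: its value is known to be
    \<open>L\<close> only after convergence is proved, and because \<open>at_left 1\<close> is a
    nontrivial filter.\<close>
  then have eq: "lin_lu_yau_curvature V E w x y = L"
    unfolding lin_lu_yau_curvature_def by (intro tendsto_Lim) auto
  show "ollivier_curvature V E 0 w x y \<le> lin_lu_yau_curvature V E w x y"
    using upper[of 0] by (simp add: eq)
  show "lin_lu_yau_curvature V E w x y \<le> 2"
    unfolding eq L_def using ollivier_curvature_ratio_le[OF assms] by (intro cSUP_least) auto
qed

section \<open>Bounds on the change of a weight in one step of the flow\<close>

lemma ollivier_flow_bounds:
  assumes "{x, y} \<in> E" "0 \<le> \<alpha>" "\<alpha> \<le> 1"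
  shows "ollivier_curvature V E \<alpha> w x y * d x y \<le> w {x, y}"
    and "- total_weight \<le> ollivier_curvature V E \<alpha> w x y * d x y"
  unfolding ollivier_curvature_times_dist[OF assms(1)]
  using wasserstein_nonneg[OF assms] wasserstein_le_total[OF assms] graph_dist_le_weight[OF assms(1)]
    graph_dist_nonneg[OF edgeD(1,2)[OF assms(1)]]
  by linarith+

lemma lin_lu_yau_flow_bounds:
  assumes "{x, y} \<in> E"
  shows "lin_lu_yau_curvature V E w x y * d x y \<le> 2 * w {x, y}"
    and "- (2 * total_weight) \<le> lin_lu_yau_curvature V E w x y * d x y"
proof -
  note d = graph_dist_nonneg[OF edgeD(1,2)[OF assms]]
  note bounds = lin_lu_yau_curvature_bounds[OF assms, THEN mult_right_mono, OF d]
  \<comment> \<open>Comparison with laziness \<open>0\<close> yields the lower bound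
    \<open>- total_weight\<close>; nonnegativity weakens it to the factor \<open>2\<close>, so that
    both bounds share one constant.\<close>
  have "0 \<le> total_weight" by (intro sum_nonneg weight_nonneg)
  then show "lin_lu_yau_curvature V E w x y * d x y \<le> 2 * w {x, y}"
    "- (2 * total_weight) \<le> lin_lu_yau_curvature V E w x y * d x y"
    using bounds graph_dist_le_weight[OF assms] ollivier_flow_bounds(2)[OF assms, of 0]
    by linarith+
qed

end

section \<open>The flow for an abstract curvature: existence, uniqueness and growth\<close>

lemma edge_cases:
  assumes "connected_graph V E" "e \<in> E"
  obtains x y where "e = {x, y}" "{x, y} \<in> E"
  using assms by (auto simp: connected_graph_def simple_graph_def)

text \<open>The constant \<open>c\<close> is \<open>1\<close> for Ollivier's and \<open>2\<close> for Lin-Lu-Yau's curvature.\<close>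

locale curvature_flow =
  fixes V :: "'a set" and E :: "'a set set" and \<kappa> :: "('a set \<Rightarrow> real) \<Rightarrow> 'a \<Rightarrow> 'a \<Rightarrow> real"
    and c s :: real and w0 :: "'a set \<Rightarrow> real"
  assumes connected: "connected_graph V E"
    and initial_pos: "\<forall>e\<in>E. 0 < w0 e"
    and constants: "0 \<le> c" "0 < s" "c * s < 1"
    and curvature_commute: "\<kappa> w x y = \<kappa> w y x"
    and curvature_le: "\<lbrakk>weighted_graph V E w; {x, y} \<in> E\<rbrakk> \<Longrightarrow>
      \<kappa> w x y * graph_dist E w x y \<le> c * w {x, y}"
    and curvature_ge: "\<lbrakk>weighted_graph V E w; {x, y} \<in> E\<rbrakk> \<Longrightarrow>
      - (c * sum w E) \<le> \<kappa> w x y * graph_dist E w x y"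
begin

definition step :: "('a set \<Rightarrow> real) \<Rightarrow> 'a \<Rightarrow> 'a \<Rightarrow> real" where
  "step w x y = w {x, y} - s * \<kappa> w x y * graph_dist E w x y"

text \<open>An edge determines its endpoints only up to order; this makes the update a well-defined
  function of the edge.\<close>

lemma step_commute: "step w x y = step w y x"
  by (simp add: step_def curvature_commute[of w x y] graph_dist_commute[of E w x y] insert_commute)

lemma step_ge:
  assumes "weighted_graph V E w" "{x, y} \<in> E"
  shows "(1 - c * s) * w {x, y} \<le> step w x y"
  using mult_left_mono[OF curvature_le[OF assms], of s] constants
  by (simp add: step_def algebra_simps)

lemma step_le:
  assumes "weighted_graph V E w" "{x, y} \<in> E"
  shows "step w x y \<le> w {x, y} + c * s * sum w E"
  using mult_left_mono[OF curvature_ge[OF assms], of s] constants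
  by (simp add: step_def algebra_simps)

abbreviation "solution \<equiv> global_solution E \<kappa> s w0"

lemma solution_weighted_graph: "solution w \<Longrightarrow> weighted_graph V E (w j)"
  using connected by unfold_locales (auto simp: global_solution_def)

lemma solution_initial: "solution w \<Longrightarrow> e \<in> E \<Longrightarrow> w 0 e = w0 e"
  by (simp add: global_solution_def)

lemma solution_Suc: "solution w \<Longrightarrow> {x, y} \<in> E \<Longrightarrow> w (Suc j) {x, y} = step (w j) x y"
  by (simp add: global_solution_def step_def)

lemma solution_unique:
  assumes "solution w" "solution w'"
  shows "w = w'"
proof
  \<comment> \<open>Weight vectors are extensional, so agreement on \<open>E\<close> is already
    equality.\<close>
  have ext: "w j = w' j" if "\<And>e. e \<in> E \<Longrightarrow> w j e = w' j e" for j
    using assms that by (intro PiE_ext[of _ E "\<lambda>_. {0<..}"]) (auto simp: global_solution_def)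
  fix j show "w j = w' j"
  proof (induction j)
    case 0
    show ?case by (rule ext) (simp add: assms solution_initial)
  next
    case (Suc j)
    have "w (Suc j) e = w' (Suc j) e" if e: "e \<in> E" for e
    proof -
      obtain x y where xy: "e = {x, y}" "{x, y} \<in> E" using edge_cases[OF connected e] .
      show ?thesis
        unfolding xy(1) solution_Suc[OF assms(1) xy(2)] solution_Suc[OF assms(2) xy(2)] Suc ..
    qed
    then show ?case by (rule ext)
  qed
qed

lemma solution_exists: "\<exists>w. solution w"
proof -
  \<comment> \<open>One step of the flow as a map on extensional weight vectors. \<open>SOME\<close>
    picks an order of the endpoints, and \<open>step_commute\<close> shows that the choice does not
    affect the value.\<close>
  define F where "F = (\<lambda>w. \<lambda>e\<in>E. let (x, y) = SOME (x, y). e = {x, y} in step w x y)"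
  have F_edge: "F w {x, y} = step w x y" if "{x, y} \<in> E" for w x y
  proof -
    obtain a b where ab: "(SOME (a, b). {x, y} = {a, b}) = (a, b)" by fastforce
    have "case SOME (a, b). {x, y} = {a, b} of (a, b) \<Rightarrow> {x, y} = {a, b}"
      by (rule someI[of _ "(x, y)"]) simp
    then have "{x, y} = {a, b}" unfolding ab by simp
    then have "step w a b = step w x y" by (auto simp: doubleton_eq_iff step_commute)
    then show ?thesis using that by (simp add: F_def ab)
  qed
  define w where "w j = (F ^^ j) (restrict w0 E)" for j
  \<comment> \<open>Positivity must be carried along the iteration: the curvature bounds hold for
    positive weights, and with \<open>c * s < 1\<close> they make the next weights positive
    again.\<close>
  have pos: "w j \<in> E \<rightarrow>\<^sub>E {0<..}" for j
  proof (induction j)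
    case 0
    then show ?case using initial_pos by (auto simp: w_def)
  next
    case (Suc j)
    have wg: "weighted_graph V E (w j)"
      using connected Suc by unfold_locales auto
    have "0 < F (w j) e" if e: "e \<in> E" for e
    proof -
      obtain x y where xy: "e = {x, y}" "{x, y} \<in> E" using edge_cases[OF connected e] .
      have "0 < (1 - c * s) * w j {x, y}"
        using constants weighted_graph.weight_pos[OF wg xy(2)] by simp
      with step_ge[OF wg xy(2)] show ?thesis by (simp add: xy F_edge)
    qed
    moreover have "F (w j) \<in> extensional E" by (simp add: F_def)
    ultimately show ?case by (auto simp: w_def PiE_iff)
  qed
  have "w (Suc j) {x, y} = step (w j) x y" if "{x, y} \<in> E" for j x y
    using F_edge[OF that] by (simp add: w_def)
  then have "solution w"
    using pos by (auto simp: global_solution_def step_def w_def)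
  then show ?thesis by (intro exI[of _ w])
qed

lemma solution_ge:
  assumes "solution w" "e \<in> E"
  shows "(1 - c * s) ^ j * w0 e \<le> w j e"
proof (induction j)
  case 0
  then show ?case using solution_initial assms by simp
next
  case (Suc j)
  obtain x y where xy: "e = {x, y}" "{x, y} \<in> E" using edge_cases[OF connected assms(2)] .
  have "(1 - c * s) ^ Suc j * w0 e \<le> (1 - c * s) * w j e"
    using mult_left_mono[OF Suc, of "1 - c * s"] constants by (simp add: mult.assoc)
  also have "\<dots> \<le> w (Suc j) e"
    using step_ge[OF solution_weighted_graph[OF assms(1)] xy(2)] solution_Suc[OF assms(1) xy(2)]
    by (simp add: xy(1))
  finally show ?case .
qed

text \<open>A single weight may grow by a multiple of the total weight, so its own recursion does
  not close. Summing the increments over all \<open>card E\<close> edges gives a recursion for the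
  total weight alone.\<close>

lemma sum_solution_le:
  assumes "solution w"
  shows "sum (w j) E \<le> (1 + c * real (card E) * s) ^ j * sum w0 E"
proof (induction j)
  case 0
  then show ?case using solution_initial[OF assms] by simp
next
  case (Suc j)
  have "sum (w (Suc j)) E \<le> (\<Sum>e\<in>E. w j e + c * s * sum (w j) E)"
  proof (rule sum_mono)
    fix e assume e: "e \<in> E"
    obtain x y where "e = {x, y}" "{x, y} \<in> E" using edge_cases[OF connected e] .
    then show "w (Suc j) e \<le> w j e + c * s * sum (w j) E"
      using step_le[OF solution_weighted_graph[OF assms]] solution_Suc[OF assms] by simp
  qed
  also have "\<dots> = (1 + c * real (card E) * s) * sum (w j) E"
    by (simp add: sum.distrib algebra_simps)
  also have "\<dots> \<le> (1 + c * real (card E) * s) ^ Suc j * sum w0 E"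
    using mult_left_mono[OF Suc, of "1 + c * real (card E) * s"] constants
    by (simp add: mult.assoc)
  finally show ?case .
qed

lemma solution_le:
  assumes "solution w" "e \<in> E"
  shows "w j e \<le> (1 + c * real (card E) * s) ^ j * sum w0 E"
proof -
  interpret weighted_graph V E "w j" by (rule solution_weighted_graph[OF assms(1)])
  have "w j e \<le> sum (w j) E"
    using assms(2) finite_edges by (intro member_le_sum) (auto intro: weight_nonneg)
  also note sum_solution_le[OF assms(1)]
  finally show ?thesis .
qed

lemma unique_solution_and_bounds:
  "(\<exists>!w. solution w) \<and>
   (\<forall>w. solution w \<longrightarrow> (\<forall>j. \<forall>e\<in>E. (1 - c * s) ^ j * w0 e \<le> w j e \<and>
      w j e \<le> (1 + c * real (card E) * s) ^ j * sum w0 E))"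
proof (intro conjI allI impI ballI)
  show "\<exists>!w. solution w" by (rule ex_ex1I[OF solution_exists solution_unique])
qed (rule solution_ge solution_le; assumption)+

end

section \<open>Specialisation of the abstract flow to the two curvatures\<close>

theorem theorem2p1:
  fixes V :: "'a set" and E :: "'a set set" and w0 :: "'a set \<Rightarrow> real"
  assumes "connected_graph V E" and "E \<noteq> {}" and "\<forall>e\<in>E. 0 < w0 e"
  shows
    "(\<forall>\<alpha> s. 0 \<le> \<alpha> \<and> \<alpha> \<le> 1 \<and> 0 < s \<and> s < 1 \<longrightarrow>
        (\<exists>!w. global_solution E (ollivier_curvature V E \<alpha>) s w0 w) \<and>
        (\<forall>w. global_solution E (ollivier_curvature V E \<alpha>) s w0 w \<longrightarrow>
          (\<forall>j. \<forall>e\<in>E. (1 - s) ^ j * w0 e \<le> w j e \<and>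
             w j e \<le> (1 + real (card E) * s) ^ j * (\<Sum>\<tau>\<in>E. w0 \<tau>)))) \<and>
     (\<forall>s. 0 < s \<and> s < 1 / 2 \<longrightarrow>
        (\<exists>!w. global_solution E (lin_lu_yau_curvature V E) s w0 w) \<and>
        (\<forall>w. global_solution E (lin_lu_yau_curvature V E) s w0 w \<longrightarrow>
          (\<forall>j. \<forall>e\<in>E. (1 - 2 * s) ^ j * w0 e \<le> w j e \<and>
             w j e \<le> (1 + 2 * real (card E) * s) ^ j * (\<Sum>\<tau>\<in>E. w0 \<tau>))))"
proof (intro conjI[of "\<forall>\<alpha> s. _ \<alpha> s" "\<forall>s. _ s"] allI impI)
  fix \<alpha> s :: real assume "0 \<le> \<alpha> \<and> \<alpha> \<le> 1 \<and> 0 < s \<and> s < 1"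
  then have "curvature_flow V E (ollivier_curvature V E \<alpha>) 1 s w0"
    using assms weighted_graph.ollivier_flow_bounds[of V E]
    by unfold_locales (simp_all, rule ollivier_curvature_commute)
  from curvature_flow.unique_solution_and_bounds[OF this]
  show "(\<exists>!w. global_solution E (ollivier_curvature V E \<alpha>) s w0 w) \<and>
        (\<forall>w. global_solution E (ollivier_curvature V E \<alpha>) s w0 w \<longrightarrow>
          (\<forall>j. \<forall>e\<in>E. (1 - s) ^ j * w0 e \<le> w j e \<and>
             w j e \<le> (1 + real (card E) * s) ^ j * (\<Sum>\<tau>\<in>E. w0 \<tau>)))"
    by simp
next
  fix s :: real assume "0 < s \<and> s < 1 / 2"
  \<comment> \<open>With \<open>c = 2\<close> the condition \<open>c * s < 1\<close> becomes
    \<open>s < 1 / 2\<close>.\<close>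
  then have "curvature_flow V E (lin_lu_yau_curvature V E) 2 s w0"
    using assms weighted_graph.lin_lu_yau_flow_bounds[of V E]
    by unfold_locales (simp_all, rule lin_lu_yau_curvature_commute)
  then show "(\<exists>!w. global_solution E (lin_lu_yau_curvature V E) s w0 w) \<and>
        (\<forall>w. global_solution E (lin_lu_yau_curvature V E) s w0 w \<longrightarrow>
          (\<forall>j. \<forall>e\<in>E. (1 - 2 * s) ^ j * w0 e \<le> w j e \<and>
             w j e \<le> (1 + 2 * real (card E) * s) ^ j * (\<Sum>\<tau>\<in>E. w0 \<tau>)))"
    by (rule curvature_flow.unique_solution_and_bounds)
qed

end
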